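(* Let $x \in \mathcal{X}$. Suppose that the model holds, i.e. $\Pr(Y=y \mid X=x, A=\alpha) = f(y \mid x,\alpha,\theta_0)$ for all $y\in\mathcal{Y}$ and $\alpha\in\mathcal{A}$, that $\pi_{\rm prior}(\alpha \mid x) > 0$ for all $\alpha \in \mathcal{A}$ and $x \in \mathcal{X}$, that $p_{\rm prior}(y \mid x,\theta_0) > 0$ for all $y \in \mathcal{Y}$, and that $f(y \mid x,\alpha,\theta_0)$ is continuous in $\alpha \in \mathcal{A}$ (for each $y\in\mathcal{Y}$). Then: (i) For every score function $s(\cdot,x,\theta_0):\mathcal{Y}\to\mathbb{R}^{d_s}$, with associated limiting bias-corrected score $s_\infty$, we have $$\mathbb{E}\left[ s_\infty(Y,X,\theta_0) \mid X=x,\, A=\alpha\right] = 0 \quad \text{for all } \alpha \in \mathcal{A}.$$ (ii) The matrix $Q(x,\theta_0)$ has a zero eigenvalue if and only if there exists a non-zero moment function $\mathfrak{m}(\cdot,x,\theta_0):\mathcal{Y}\to\mathbb{R}$ (i.e. not identically zero in $y\in\mathcal{Y}$) that satisfies $$\mathbb{E}\left[ \mathfrak{m}(Y,X,\theta_0) \mid X=x,\, A=\alpha\right] = 0 \quad \text{for all } \alpha \in \mathcal{A}.$$ (iii) For every moment function $\mathfrak{m}(\cdot,x,\theta_0):\mathcal{Y}\to\mathbb{R}$ that satisfies the displayed condition in part (ii), there exists a function $s(\cdot,x,\theta_0):\mathcal{Y}\to\mathbb{R}$ such that the limiting bias-corrected score $s_\infty$ associated with $s$ satisfies $$\mathfrak{m}(y,x,\theta_0)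 = s_\infty(y,x,\theta_0) \quad \text{for all } y \in \mathcal{Y}.$$
   Context: Setting. $\mathcal{Y}=\{y_{(1)},\ldots,y_{(n_{\mathcal Y})}\}$ is a finite outcome set with $n_{\mathcal Y}$ elements, $\mathcal{X}$ is a set of covariate values, $\Theta\subset\mathbb{R}^{d_\theta}$ is a parameter set, $\theta_0\in\Theta$. $\mathcal{A}$ is the set of possible values of a latent variable $A$; it is a topological space (e.g. a subset of a Euclidean space) with a fixed Borel reference measure, written ${\rm d}\alpha$, that gives positive measure to every nonempty (relatively) open subset of $\mathcal{A}$. The model is a known function $f$ such that for each $x\in\mathcal{X}$, $\alpha\in\mathcal{A}$, $\theta\in\Theta$, $f(\cdot\mid x,\alpha,\theta)$ is a probability mass function on $\mathcal{Y}$, measurable in $\alpha$. Conditional expectations are computed from the model: $\mathbb{E}[g(Y,X)\mid X=x,A=\alpha] = \sum_{y\in\mathcal{Y}} g(y,x)\, f(y\mid x,\alpha,\theta_0)$. Prior and posterior. $\pi_{\rm prior}(\cdot\mid x)$ is a chosen density on $\mathcal{A}$ with $\int_{\mathcal A}\pi_{\rm prior}(\alpha\mid x)\,{\rm d}\alpha=1$ for all $x\in\mathcal{X}$. Define $$p_{\rm prior}(y\mid x,\theta)=\int_{\mathcal A} f(y\mid x,\alpha,\theta)\,\pi_{\rm prior}(\alpha\mid x)\,{\rm d}\alpha,\qquad \pi_{\rm post}(\alpha\mid y,x,\theta)=\frac{f(y\mid x,\alpha,\theta)\,\pi_{\rm prior}(\alpha\mid x)}{p_{\rm prior}(y\mid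 x,\theta)}.$$ Posterior predictive matrix. $Q(\widetilde y\mid y,x,\theta)=\int_{\mathcal A} f(\widetilde y\mid x,\alpha,\theta)\,\pi_{\rm post}(\alpha\mid y,x,\theta)\,{\rm d}\alpha$, and $Q(x,\theta)$ is the $n_{\mathcal Y}\times n_{\mathcal Y}$ matrix with $(k,\ell)$ entry $Q(y_{(k)}\mid y_{(\ell)},x,\theta)$. Bias-corrected scores. For a function $s(\cdot,x,\theta):\mathcal{Y}\to\mathbb{R}^{d_s}$ (a "score function"), let $S(x,\theta)$ be the $d_s\times n_{\mathcal Y}$ matrix with columns $s(y_{(k)},x,\theta)$, $k=1,\ldots,n_{\mathcal Y}$, and let $\delta(y)\in\mathbb{R}^{n_{\mathcal Y}}$ be the vector with entries $\mathbb{1}(y=y_{(k)})$. For $q\in\{1,2,\ldots\}$ define $$s^{(q)}(y,x,\theta)=S(x,\theta)\,[\mathbb{I}_{n_{\mathcal Y}}-Q(x,\theta)]^q\,\delta(y),\qquad s_\infty(y,x,\theta)=\lim_{q\to\infty}s^{(q)}(y,x,\theta).$$ The limit exists because, when $p_{\rm prior}(y\mid x,\theta)>0$ for all $y$, $Q(x,\theta)$ is diagonalizable with all eigenvalues in $[0,1]$. Equivalently, if $Q(x,\theta)=U\,{\rm diag}(\lambda_k)_{k}\,U^{-1}$, then $s_\infty(y,x,\theta)=S(x,\theta)\,U\,{\rm diag}(\mathbb{1}\{\lambda_k=0\})_{k}\,U^{-1}\,\delta(y)$. *)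

theory Defs
  imports "HOL-Probability.Probability"
begin

(* Conventions.  The finite outcome set is the type 'y, which also indexes rows and columns
   of the matrices.  The set of latent values is space M, where M is the reference measure
   (written d alpha).  The model is f y x alpha theta, the prior density is prior alpha x. *)

definition p_prior ::
  "'a measure \<Rightarrow> ('y \<Rightarrow> 'x \<Rightarrow> 'a \<Rightarrow> 't \<Rightarrow> real) \<Rightarrow> ('a \<Rightarrow> 'x \<Rightarrow> real) \<Rightarrow> 'y \<Rightarrow> 'x \<Rightarrow> 't \<Rightarrow> real"
  where "p_prior M f prior y x \<theta> = (LINT \<alpha>|M. f y x \<alpha> \<theta> * prior \<alpha> x)"

definition post_density ::
  "'a measure \<Rightarrow> ('y \<Rightarrow> 'x \<Rightarrow> 'a \<Rightarrow> 't \<Rightarrow> real) \<Rightarrow> ('a \<Rightarrow> 'x \<Rightarrow> real) \<Rightarrow> 'a \<Rightarrow> 'y \<Rightarrow> 'x \<Rightarrow> 't \<Rightarrow> real"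
  where "post_density M f prior \<alpha> y x \<theta> = f y x \<alpha> \<theta> * prior \<alpha> x / p_prior M f prior y x \<theta>"

definition post_predictive ::
  "'a measure \<Rightarrow> ('y \<Rightarrow> 'x \<Rightarrow> 'a \<Rightarrow> 't \<Rightarrow> real) \<Rightarrow> ('a \<Rightarrow> 'x \<Rightarrow> real) \<Rightarrow> 'y \<Rightarrow> 'y \<Rightarrow> 'x \<Rightarrow> 't \<Rightarrow> real"
  where "post_predictive M f prior y' y x \<theta> =
    (LINT \<alpha>|M. f y' x \<alpha> \<theta> * post_density M f prior \<alpha> y x \<theta>)"

definition Q_matrix ::
  "'a measure \<Rightarrow> ('y::finite \<Rightarrow> 'x \<Rightarrow> 'a \<Rightarrow> 't \<Rightarrow> real) \<Rightarrow> ('a \<Rightarrow> 'x \<Rightarrow> real) \<Rightarrow> 'x \<Rightarrow> 't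
    \<Rightarrow> real ^ 'y ^ 'y"
  where "Q_matrix M f prior x \<theta> = (\<chi> k l. post_predictive M f prior k l x \<theta>)"

(* The type real ^ 'n ^ 'n has componentwise multiplication, so ^ is not the matrix power. *)
primrec matrix_power :: "real ^ 'n ^ 'n \<Rightarrow> nat \<Rightarrow> real ^ 'n ^ 'n::finite"
  where
    "matrix_power A 0 = mat 1"
  | "matrix_power A (Suc q) = A ** matrix_power A q"

definition eigenvalue :: "real ^ 'n ^ 'n::finite \<Rightarrow> real \<Rightarrow> bool"
  where "eigenvalue A c \<longleftrightarrow> (\<exists>v. v \<noteq> 0 \<and> A *v v = c *\<^sub>R v)"

definition score_matrix ::
  "('y::finite \<Rightarrow> 'x \<Rightarrow> 't \<Rightarrow> real ^ 's) \<Rightarrow> 'x \<Rightarrow> 't \<Rightarrow> real ^ 'y ^ 's::finite"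
  where "score_matrix s x \<theta> = (\<chi> i k. s k x \<theta> $ i)"

definition bias_corrected_score ::
  "'a measure \<Rightarrow> ('y::finite \<Rightarrow> 'x \<Rightarrow> 'a \<Rightarrow> 't \<Rightarrow> real) \<Rightarrow> ('a \<Rightarrow> 'x \<Rightarrow> real)
    \<Rightarrow> ('y \<Rightarrow> 'x \<Rightarrow> 't \<Rightarrow> real ^ 's::finite) \<Rightarrow> nat \<Rightarrow> 'y \<Rightarrow> 'x \<Rightarrow> 't \<Rightarrow> real ^ 's"
  where "bias_corrected_score M f prior s q y x \<theta> =
    (score_matrix s x \<theta> ** matrix_power (mat 1 - Q_matrix M f prior x \<theta>) q) *v axis y 1"

(* The limit exists whenever p_prior M f prior y x theta > 0 for all y. *)
definition limit_score ::
  "'a measure \<Rightarrow> ('y::finite \<Rightarrow> 'x \<Rightarrow> 'a \<Rightarrow> 't \<Rightarrow> real) \<Rightarrow> ('a \<Rightarrow> 'x \<Rightarrow> real)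
    \<Rightarrow> ('y \<Rightarrow> 'x \<Rightarrow> 't \<Rightarrow> real ^ 's::finite) \<Rightarrow> 'y \<Rightarrow> 'x \<Rightarrow> 't \<Rightarrow> real ^ 's"
  where "limit_score M f prior s y x \<theta> =
    lim (\<lambda>q. bias_corrected_score M f prior s q y x \<theta>)"

(* E[g(Y,X) | X = x, A = alpha], where P x alpha is the conditional distribution of Y
   given X = x, A = alpha. *)
definition cond_expectation ::
  "('x \<Rightarrow> 'a \<Rightarrow> 'y pmf) \<Rightarrow> ('y \<Rightarrow> 'x \<Rightarrow> 'b::{banach, second_countable_topology}) \<Rightarrow> 'x \<Rightarrow> 'a \<Rightarrow> 'b"
  where "cond_expectation P g x \<alpha> = measure_pmf.expectation (P x \<alpha>) (\<lambda>y. g y x)"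

end

theory Submission
  imports Defs
begin

text \<open>
  Write \<open>G\<close> for the Gram matrix of the functions \<open>f y\<close> in \<open>L\<^sup>2\<close> of the prior and \<open>D\<close> for the diagonal
  matrix of the prior predictive probabilities, so that \<open>Q = G D\<^sup>-\<^sup>1\<close>. Then \<open>m\<^sup>T G m\<close> is the prior
  integral of the square of \<open>\<Sum>y. m y * f y\<close>; as the prior is positive, open sets have positive
  measure and \<open>f\<close> is continuous, \<open>m\<close> is a moment function iff \<open>G m = 0\<close>. Moreover \<open>Q\<close> is similar to
  \<open>A = D\<^sup>-\<^sup>1\<^sup>/\<^sup>2 G D\<^sup>-\<^sup>1\<^sup>/\<^sup>2\<close>, which is symmetric with \<open>0 \<le> A \<le> 1\<close> by Jensen's inequality, and hence
  \<open>(1 - A)\<^sup>q\<close> converges to the projection onto the kernel of \<open>A\<close>.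
\<close>

section \<open>Powers of \<open>1 - A\<close> for a self-adjoint operator \<open>A\<close> with 0
  \<le> \<open>A\<close> \<le> 1\<close>

lemma selfadjoint_norm_le_form:
  fixes A :: "'a::euclidean_space \<Rightarrow> 'a"
  assumes lin: "linear A"
    and sym: "\<And>v w. A v \<bullet> w = v \<bullet> A w"
    and pos: "\<And>v. 0 \<le> A v \<bullet> v"
    and le: "\<And>v. A v \<bullet> v \<le> v \<bullet> v"
  shows "A v \<bullet> A v \<le> A v \<bullet> v"
proof -
  \<comment> \<open>\<open>A - A\<^sup>2 = A (1 - A) A + (1 - A) A (1 - A)\<close>\<close>
  have "0 \<le> A (v - A v) \<bullet> (v - A v)" "A (A v) \<bullet> A v \<le> A v \<bullet> A v"
    by (rule pos, rule le)
  moreover have "A (v - A v) \<bullet> (v - A v) = A v \<bullet> v - 2 * (A v \<bullet> A v) + A (A v) \<bullet> A v"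
    by (simp add: linear_diff[OF lin] inner_diff_left inner_diff_right sym)
  ultimately show ?thesis by simp
qed

text \<open>With \<open>T = 1 - A\<close>, split \<open>u\<close> orthogonally into a part in the
  range of \<open>A\<close> and a rest \<open>z\<close>. Self-adjointness puts \<open>z\<close> into
  the kernel of \<open>A\<close>, so \<open>T\<close> fixes it; on the range the powers of
  \<open>T\<close> tend to 0 by an energy estimate, without diagonalizing \<open>A\<close>.\<close>

lemma selfadjoint_powers_converge:
  fixes A :: "'a::euclidean_space \<Rightarrow> 'a"
  assumes lin: "linear A"
    and sym: "\<And>v w. A v \<bullet> w = v \<bullet> A w"
    and pos: "\<And>v. 0 \<le> A v \<bullet> v"
    and le: "\<And>v. A v \<bullet> v \<le> v \<bullet> v"
  obtains z where "A z = 0" "(\<lambda>q. ((\<lambda>v. v - A v) ^^ q) u) \<longlonglongrightarrow> z"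
proof -
  define T where "T = (\<lambda>v. v - A v)"
  have linTq: "linear (T ^^ q)" for q
  proof (induction q)
    case 0
    show ?case using linear_ident by (simp add: id_def)
  next
    case (Suc q)
    have "linear T"
      unfolding T_def by (intro linear_compose_sub linear_ident lin)
    with Suc show ?case using linear_compose[of "T ^^ q" T] by (simp add: o_def)
  qed
  have comm: "(T ^^ q) (A w) = A ((T ^^ q) w)" for q w
    by (induction q) (auto simp: T_def linear_diff[OF lin])
  \<comment> \<open>The right-hand side equals
    \<open>2 * (A v \<bullet> v) - A v \<bullet> A v\<close>, so this is just the inequality between
    \<open>A v \<bullet> A v\<close> and \<open>A v \<bullet> v\<close>. It telescopes along the
    orbit of \<open>T\<close>, making the squared norms of \<open>A ((T ^^ q) w)\<close>
    summable.\<close>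
  have decay: "A v \<bullet> A v \<le> v \<bullet> v - T v \<bullet> T v" for v
    using selfadjoint_norm_le_form[OF assms, of v]
    by (simp add: T_def inner_diff_left inner_diff_right inner_commute)
  have range0: "(\<lambda>q. (T ^^ q) (A w)) \<longlonglongrightarrow> 0" for w
  proof -
    let ?n = "\<lambda>q. (T ^^ q) w \<bullet> (T ^^ q) w"
    have partial: "(\<Sum>q<n. A ((T ^^ q) w) \<bullet> A ((T ^^ q) w)) \<le> w \<bullet> w - ?n n" for n
    proof (induction n)
      case (Suc n)
      then show ?case using decay[of "(T ^^ n) w"] by simp
    qed simp
    have "summable (\<lambda>q. A ((T ^^ q) w) \<bullet> A ((T ^^ q) w))"
    proof (rule summableI_nonneg_bounded)
      show "(\<Sum>q<n. A ((T ^^ q) w) \<bullet> A ((T ^^ q) w)) \<le> w \<bullet> w" for n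
        using partial[of n] inner_ge_zero[of "(T ^^ n) w"] by linarith
    qed simp
    then have "(\<lambda>q. (norm (A ((T ^^ q) w)))\<^sup>2) \<longlonglongrightarrow> 0"
      using summable_LIMSEQ_zero by (simp add: power2_norm_eq_inner)
    then have "(\<lambda>q. sqrt ((norm (A ((T ^^ q) w)))\<^sup>2)) \<longlonglongrightarrow> sqrt 0"
      by (rule tendsto_real_sqrt)
    then show ?thesis
      by (simp add: comm tendsto_norm_zero_iff)
  qed
  obtain y z where yz: "y \<in> span (range A)" "\<And>w. w \<in> span (range A) \<Longrightarrow> orthogonal z w" "u = y + z"
    by (rule orthogonal_subspace_decomp_exists[of "range A" u]) blast
  have "span (range A) = range A"
    by (simp add: lin linear_subspace_image span_eq_iff)
  then obtain w where w: "y = A w" using yz(1) by blast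
  \<comment> \<open>\<open>z\<close> is orthogonal to the range of \<open>A\<close>, which contains
    \<open>A (A z)\<close>.\<close>
  have "A z \<bullet> A z = z \<bullet> A (A z)" by (rule sym)
  also have "\<dots> = 0" using yz(2)[of "A (A z)"] by (simp add: orthogonal_def span_base)
  finally have Az: "A z = 0" by simp
  have "(T ^^ q) z = z" for q
    by (induction q) (auto simp: T_def Az)
  then have "(T ^^ q) u = (T ^^ q) (A w) + z" for q
    by (simp add: yz(3) w linear_add[OF linTq])
  then have "(\<lambda>q. (T ^^ q) u) \<longlonglongrightarrow> z"
    using tendsto_add[OF range0 tendsto_const, of w z] by simp
  with Az show thesis by (auto intro: that simp: T_def)
qed

section \<open>Row vectors under powers of \<open>1 - Q\<close>, by symmetrization\<close>

text \<open>Scores multiply the matrix from the left, hence the row action. With D the diagonal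
  matrix of \<open>p\<close>, \<open>Q\<close> is G D^(-1), and the last hypothesis says
  \<open>G\<close> \<le> D as quadratic forms. Conjugating by D^(1/2) turns this into the
  self-adjoint case.\<close>

lemma symmetrizable_row_powers_converge:
  fixes G Q :: "real ^ 'n ^ 'n::finite" and p :: "'n \<Rightarrow> real"
  assumes p: "\<And>k. p k > 0"
    and Q: "\<And>k l. Q $ k $ l = G $ k $ l / p l"
    and sym: "transpose G = G"
    and pos: "\<And>u. 0 \<le> (G *v u) \<bullet> u"
    and le: "\<And>u. (G *v u) \<bullet> u \<le> (\<Sum>k\<in>UNIV. p k * (u $ k)\<^sup>2)"
  obtains z where "G *v z = 0" "(\<lambda>q. u v* matrix_power (mat 1 - Q) q) \<longlonglongrightarrow> z"
proof -
  \<comment> \<open>\<open>L\<close> is D^(-1/2) and \<open>R\<close> is its inverse D^(1/2);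
    \<open>A\<close> is the symmetric matrix similar to \<open>Q\<close>.\<close>
  define L where "L = (\<lambda>v :: real ^ 'n. \<chi> k. v $ k / sqrt (p k))"
  define R where "R = (\<lambda>v :: real ^ 'n. \<chi> k. sqrt (p k) * v $ k)"
  define A where "A = (\<lambda>v. L (G *v L v))"
  define T where "T = (\<lambda>v. v - A v)"
  have sp: "sqrt (p k) > 0" "sqrt (p k) \<noteq> 0" for k using p[of k] by auto
  have linL: "linear L" by (rule linearI) (auto simp: L_def vec_eq_iff add_divide_distrib)
  have LR: "L (R v) = v" and RL: "R (L v) = v" for v
    using sp by (auto simp: L_def R_def vec_eq_iff)
  have Lsym: "L v \<bullet> w = v \<bullet> L w" for v w
    by (simp add: L_def inner_vec_def)
  have Gsym: "(G *v v) \<bullet> w = v \<bullet> (G *v w)" for v w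
    using dot_lmul_matrix[of v G w] transpose_matrix_vector[of G v] sym by simp
  have linA: "linear A"
    unfolding A_def using linear_compose[OF linear_compose[OF linL matrix_vector_mul_linear] linL]
    by (simp add: o_def)
  have symA: "A v \<bullet> w = v \<bullet> A w" for v w
    by (simp add: A_def Lsym Gsym)
  have formA: "A v \<bullet> v = (G *v L v) \<bullet> L v" for v
    by (simp add: A_def Lsym)
  have leA: "A v \<bullet> v \<le> v \<bullet> v" for v
  proof -
    have "p k * (v $ k / sqrt (p k))\<^sup>2 = v $ k * v $ k" for k
      using p[of k] by (simp add: power_divide power2_eq_square)
    then have "(\<Sum>k\<in>UNIV. p k * (L v $ k)\<^sup>2) = v \<bullet> v"
      by (simp add: L_def inner_vec_def)
    then show ?thesis using le[of "L v"] by (simp add: formA)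
  qed
  obtain z where z: "A z = 0" "(\<lambda>q. (T ^^ q) (R u)) \<longlonglongrightarrow> z"
    using selfadjoint_powers_converge[OF linA symA _ leA, of "R u"] pos
    unfolding T_def formA by blast
  \<comment> \<open>Written as a column, the row v G D^(-1) is D^(-1) G v by symmetry of
    \<open>G\<close>, and D^(-1) is \<open>L\<close> applied twice. Inserting
    \<open>L (R v) = v\<close> makes this \<open>L (A (R v))\<close>.\<close>
  have rowQ: "v v* Q = L (L (G *v v))" for v
  proof -
    have "G $ k $ l = G $ l $ k" for k l
      using arg_cong[OF sym, of "\<lambda>B. B $ l $ k"] by (simp add: transpose_def)
    then show ?thesis using p
      by (simp add: vec_eq_iff L_def vector_matrix_mult_def matrix_vector_mult_def Q
          sum_divide_distrib order_less_imp_le mult.commute)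
  qed
  have step: "v v* (mat 1 - Q) = L (T (R v))" for v
    by (simp add: T_def A_def LR linear_diff[OF linL] rowQ vector_matrix_mult_diff_rdistrib)
  \<comment> \<open>\<open>matrix_power\<close> splits off its factor on the left, which meets the
    row first; the induction hypothesis is therefore needed at the row already multiplied by
    \<open>mat 1 - Q\<close>.\<close>
  have "v v* matrix_power (mat 1 - Q) q = L ((T ^^ q) (R v))" for v q
  proof (induction q arbitrary: v)
    case 0
    show ?case by (simp add: LR)
  next
    case (Suc q)
    show ?case
      by (simp add: vector_matrix_mul_assoc[symmetric] Suc step RL funpow_swap1)
  qed
  moreover have "(\<lambda>q. L ((T ^^ q) (R u))) \<longlonglongrightarrow> L z"
    using linL by (intro isCont_tendsto_compose[OF _ z(2)] linear_continuous_at)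
      (simp add: linear_conv_bounded_linear)
  \<comment> \<open>\<open>A z = 0\<close> reads \<open>L (G *v L z) = 0\<close>, and
    \<open>R\<close> cancels the outer \<open>L\<close>.\<close>
  moreover have "G *v L z = 0"
  proof -
    have "R (A z) = R 0" by (simp add: z)
    then show ?thesis unfolding A_def RL by (simp add: R_def vec_eq_iff)
  qed
  ultimately show thesis by (intro that[of "L z"]) simp_all
qed

section \<open>The Gram matrix of the model probabilities under the prior\<close>

text \<open>The model frozen at one covariate value and one parameter: \<open>w y \<alpha>\<close>
  stands for the probability of \<open>y\<close> given \<open>\<alpha>\<close>, and
  \<open>\<pi>\<close> for the prior density.\<close>

locale weighted_mixture =
  fixes M :: "'a measure" and w :: "'y::finite \<Rightarrow> 'a \<Rightarrow> real" and \<pi> :: "'a \<Rightarrow> real"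
  assumes weight_integrable: "integrable M \<pi>"
    and weight_pos: "\<And>\<alpha>. \<alpha> \<in> space M \<Longrightarrow> \<pi> \<alpha> > 0"
    and component_measurable [measurable]: "\<And>y. w y \<in> borel_measurable M"
    and component_nonneg: "\<And>y \<alpha>. \<alpha> \<in> space M \<Longrightarrow> 0 \<le> w y \<alpha>"
    and component_sum: "\<And>\<alpha>. \<alpha> \<in> space M \<Longrightarrow> (\<Sum>y\<in>UNIV. w y \<alpha>) = 1"
begin

definition gram :: "real ^ 'y ^ 'y"
  where "gram = (\<chi> k l. LINT \<alpha>|M. w k \<alpha> * w l \<alpha> * \<pi> \<alpha>)"

lemma component_le_one:
  assumes "\<alpha> \<in> space M"
  shows "w y \<alpha> \<le> 1"
  using member_le_sum[of y UNIV "\<lambda>y. w y \<alpha>"] component_nonneg[OF assms] component_sum[OF assms]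
  by simp

lemma integrable_component: "integrable M (\<lambda>\<alpha>. w k \<alpha> * \<pi> \<alpha>)"
proof (rule Bochner_Integration.integrable_bound[OF weight_integrable])
  show "(\<lambda>\<alpha>. w k \<alpha> * \<pi> \<alpha>) \<in> borel_measurable M"
    using weight_integrable by measurable
  show "AE \<alpha> in M. norm (w k \<alpha> * \<pi> \<alpha>) \<le> norm (\<pi> \<alpha>)"
  proof (rule AE_I2)
    fix \<alpha> assume \<alpha>: "\<alpha> \<in> space M"
    show "norm (w k \<alpha> * \<pi> \<alpha>) \<le> norm (\<pi> \<alpha>)"
      using component_le_one[OF \<alpha>] component_nonneg[OF \<alpha>] by (simp add: abs_mult mult_left_le_one_le)
  qed
qed

lemma integrable_component_product: "integrable M (\<lambda>\<alpha>. w k \<alpha> * w l \<alpha> * \<pi> \<alpha>)"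
proof (rule Bochner_Integration.integrable_bound[OF integrable_component])
  show "(\<lambda>\<alpha>. w k \<alpha> * w l \<alpha> * \<pi> \<alpha>) \<in> borel_measurable M"
    using weight_integrable by measurable
  show "AE \<alpha> in M. norm (w k \<alpha> * w l \<alpha> * \<pi> \<alpha>) \<le> norm (w l \<alpha> * \<pi> \<alpha>)"
  proof (rule AE_I2)
    fix \<alpha> assume \<alpha>: "\<alpha> \<in> space M"
    show "norm (w k \<alpha> * w l \<alpha> * \<pi> \<alpha>) \<le> norm (w l \<alpha> * \<pi> \<alpha>)"
      using component_le_one[OF \<alpha>] component_nonneg[OF \<alpha>]
      by (simp add: abs_mult mult_left_le_one_le mult.assoc)
  qed
qed

lemma transpose_gram: "transpose gram = gram"
  by (simp add: gram_def transpose_def mult.commute[of "w _ _" "w _ _"])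

lemma square_expand:
  "(\<Sum>y\<in>UNIV. u $ y * w y \<alpha>)\<^sup>2 * \<pi> \<alpha>
    = (\<Sum>k\<in>UNIV. \<Sum>l\<in>UNIV. u $ k * u $ l * (w k \<alpha> * w l \<alpha> * \<pi> \<alpha>))"
proof -
  have "(\<Sum>y\<in>UNIV. u $ y * w y \<alpha>)\<^sup>2
      = (\<Sum>k\<in>UNIV. \<Sum>l\<in>UNIV. (u $ k * w k \<alpha>) * (u $ l * w l \<alpha>))"
    unfolding power2_eq_square by (rule sum_product)
  then show ?thesis
    by (simp add: sum_distrib_right sum_distrib_left mult_ac)
qed

lemma integrable_square: "integrable M (\<lambda>\<alpha>. (\<Sum>y\<in>UNIV. u $ y * w y \<alpha>)\<^sup>2 * \<pi> \<alpha>)"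
  unfolding square_expand
  by (intro Bochner_Integration.integrable_sum integrable_mult_right integrable_component_product)

lemma gram_form: "(gram *v u) \<bullet> u = (LINT \<alpha>|M. (\<Sum>y\<in>UNIV. u $ y * w y \<alpha>)\<^sup>2 * \<pi> \<alpha>)"
proof -
  have "(LINT \<alpha>|M. (\<Sum>y\<in>UNIV. u $ y * w y \<alpha>)\<^sup>2 * \<pi> \<alpha>)
      = (\<Sum>k\<in>UNIV. \<Sum>l\<in>UNIV. u $ k * u $ l * gram $ k $ l)"
    unfolding square_expand
    by (simp add: Bochner_Integration.integral_sum Bochner_Integration.integrable_sum
        integrable_component_product gram_def)
  then show ?thesis
    by (simp add: inner_vec_def matrix_vector_mult_def sum_distrib_right sum_distrib_left mult_ac)
qed

lemma gram_form_nonneg: "0 \<le> (gram *v u) \<bullet> u"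
  unfolding gram_form
  by (rule Bochner_Integration.integral_nonneg) (simp add: weight_pos order_less_imp_le)

text \<open>For fixed \<open>\<alpha>\<close> the weights \<open>w y \<alpha>\<close> form a
  probability distribution, and the variance of \<open>u\<close> under it is nonnegative;
  \<open>h\<close> is its mean.\<close>

lemma square_mean_le:
  assumes \<alpha>: "\<alpha> \<in> space M"
  shows "(\<Sum>y\<in>UNIV. u $ y * w y \<alpha>)\<^sup>2 \<le> (\<Sum>y\<in>UNIV. (u $ y)\<^sup>2 * w y \<alpha>)"
proof -
  define h where "h = (\<Sum>y\<in>UNIV. u $ y * w y \<alpha>)"
  have "0 \<le> (\<Sum>y\<in>UNIV. (u $ y - h)\<^sup>2 * w y \<alpha>)"
    by (intro sum_nonneg) (simp add: component_nonneg[OF \<alpha>])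
  also have "\<dots> = (\<Sum>y\<in>UNIV. (u $ y)\<^sup>2 * w y \<alpha> - 2 * h * (u $ y * w y \<alpha>) + h\<^sup>2 * w y \<alpha>)"
    by (intro sum.cong) (auto simp: power2_eq_square algebra_simps)
  also have "\<dots> = (\<Sum>y\<in>UNIV. (u $ y)\<^sup>2 * w y \<alpha>) - 2 * h * h + h\<^sup>2 * 1"
    unfolding component_sum[OF \<alpha>, symmetric]
    by (simp only: sum.distrib sum_subtractf sum_distrib_left[symmetric] h_def)
  finally show ?thesis by (simp add: h_def power2_eq_square)
qed

text \<open>Integrating the pointwise Jensen inequality against \<open>\<pi>\<close> bounds the Gram
  form by the diagonal form of the prior predictive probabilities. This is what keeps the
  eigenvalues of \<open>Q\<close> at most 1.\<close>

lemma gram_form_le: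
  "(gram *v u) \<bullet> u \<le> (\<Sum>k\<in>UNIV. (LINT \<alpha>|M. w k \<alpha> * \<pi> \<alpha>) * (u $ k)\<^sup>2)"
proof -
  have int: "integrable M (\<lambda>\<alpha>. \<Sum>k\<in>UNIV. (u $ k)\<^sup>2 * (w k \<alpha> * \<pi> \<alpha>))"
    by (intro Bochner_Integration.integrable_sum integrable_mult_right integrable_component)
  have "(gram *v u) \<bullet> u \<le> (LINT \<alpha>|M. (\<Sum>k\<in>UNIV. (u $ k)\<^sup>2 * (w k \<alpha> * \<pi> \<alpha>)))"
    unfolding gram_form
  proof (rule integral_mono[OF integrable_square int])
    fix \<alpha> assume \<alpha>: "\<alpha> \<in> space M"
    show "(\<Sum>y\<in>UNIV. u $ y * w y \<alpha>)\<^sup>2 * \<pi> \<alpha> \<le> (\<Sum>k\<in>UNIV. (u $ k)\<^sup>2 * (w k \<alpha> * \<pi> \<alpha>))"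
      using mult_right_mono[OF square_mean_le[OF \<alpha>, of u], of "\<pi> \<alpha>"] weight_pos[OF \<alpha>]
      by (simp add: sum_distrib_right mult.assoc)
  qed
  also have "\<dots> = (\<Sum>k\<in>UNIV. (LINT \<alpha>|M. w k \<alpha> * \<pi> \<alpha>) * (u $ k)\<^sup>2)"
    by (subst Bochner_Integration.integral_sum)
      (simp_all add: integrable_component mult.commute[of _ "(u $ _)\<^sup>2"])
  finally show ?thesis .
qed

text \<open>If \<open>gram *v u = 0\<close>, the form at \<open>u\<close> vanishes; its integrand is
  nonnegative, hence zero a.e., and positivity of \<open>\<pi>\<close> removes the weight.
  Conversely, each entry of \<open>gram *v u\<close> integrates a multiple of the mixture
  sum.\<close>

lemma gram_kernel_AE:
  "gram *v u = 0 \<longleftrightarrow> (AE \<alpha> in M. (\<Sum>y\<in>UNIV. u $ y * w y \<alpha>) = 0)"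
proof
  assume "gram *v u = 0"
  then have "(LINT \<alpha>|M. (\<Sum>y\<in>UNIV. u $ y * w y \<alpha>)\<^sup>2 * \<pi> \<alpha>) = 0"
    using gram_form[of u] by simp
  then have "AE \<alpha> in M. (\<Sum>y\<in>UNIV. u $ y * w y \<alpha>)\<^sup>2 * \<pi> \<alpha> = 0"
    by (subst (asm) integral_nonneg_eq_0_iff_AE[OF integrable_square])
      (auto simp: weight_pos order_less_imp_le)
  then show "AE \<alpha> in M. (\<Sum>y\<in>UNIV. u $ y * w y \<alpha>) = 0"
    by (rule AE_mp) (auto intro!: AE_I2 dest: weight_pos)
next
  assume ae: "AE \<alpha> in M. (\<Sum>y\<in>UNIV. u $ y * w y \<alpha>) = 0"
  show "gram *v u = 0"
  proof (subst vec_eq_iff, rule allI)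
    fix k
    have "(gram *v u) $ k = (LINT \<alpha>|M. (\<Sum>l\<in>UNIV. u $ l * (w k \<alpha> * w l \<alpha> * \<pi> \<alpha>)))"
      by (subst Bochner_Integration.integral_sum)
        (simp_all add: integrable_component_product gram_def matrix_vector_mult_def mult.commute[of _ "u $ _"])
    also have "\<dots> = (LINT \<alpha>|M. w k \<alpha> * \<pi> \<alpha> * (\<Sum>l\<in>UNIV. u $ l * w l \<alpha>))"
      by (simp add: sum_distrib_left mult_ac)
    also have "\<dots> = 0"
      by (rule integral_eq_zero_AE) (use ae in auto)
    finally show "(gram *v u) $ k = 0 $ k" by simp
  qed
qed

end

text \<open>By continuity the set where \<open>h\<close> is nonzero is relatively open; if nonempty
  it would have positive measure, yet it is null.\<close>

lemma AE_zero_imp_zero_of_continuous_on: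
  fixes h :: "'a::topological_space \<Rightarrow> real"
  assumes borel: "sets M = sets (restrict_space borel A)"
    and open_pos: "\<And>U. open U \<Longrightarrow> U \<inter> A \<noteq> {} \<Longrightarrow> emeasure M (U \<inter> A) > 0"
    and cont: "continuous_on A h"
    and ae: "AE \<alpha> in M. h \<alpha> = 0"
    and \<alpha>: "\<alpha> \<in> A"
  shows "h \<alpha> = 0"
proof (rule ccontr)
  assume nz: "h \<alpha> \<noteq> 0"
  have space: "space M = A"
    using sets_eq_imp_space_eq[OF borel] by (simp add: space_restrict_space)
  obtain U where U: "open U" "U \<inter> A = h -` (- {0}) \<inter> A"
    using cont open_Compl[OF closed_singleton, of "0::real"] unfolding continuous_on_open_invariant by blast
  have "A \<inter> U \<in> sets (restrict_space borel A)"
    using U(1) by (auto simp: sets_restrict_space)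
  then have "U \<inter> A \<in> sets M"
    by (simp add: borel Int_commute)
  moreover have "U \<inter> A = {\<alpha> \<in> space M. h \<alpha> \<noteq> 0}"
    using U(2) by (auto simp: space)
  ultimately have "emeasure M (U \<inter> A) = 0"
    using ae by (simp add: AE_iff_measurable)
  moreover have "U \<inter> A \<noteq> {}"
    using U(2) nz \<alpha> by auto
  ultimately show False using open_pos[OF U(1)] by simp
qed

section \<open>Scores in coordinates, and the three claims\<close>

text \<open>Each coordinate of the score evolves separately, as one row of the score matrix; this
  reduces vector-valued scores to the row-vector convergence result.\<close>

lemma bias_corrected_score_component:
  "bias_corrected_score M f prior s q y x \<theta> $ i
    = ((\<chi> k. s k x \<theta> $ i) v* matrix_power (mat 1 - Q_matrix M f prior x \<theta>) q) $ y"
  by (simp add: bias_corrected_score_def matrix_vector_mult_basis column_def score_matrix_def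
      matrix_matrix_mult_def vector_matrix_mult_def)

lemma cond_expectation_finite:
  fixes P :: "'x \<Rightarrow> 'a \<Rightarrow> 'y::finite pmf"
  shows "cond_expectation P g x \<alpha> = (\<Sum>y\<in>UNIV. pmf (P x \<alpha>) y *\<^sub>R g y x)"
  unfolding cond_expectation_def by (rule integral_measure_pmf) auto

theorem lemma2:
  fixes \<A> :: "'a::topological_space set"
    and M :: "'a measure"
    and \<X> :: "'x set"
    and \<Theta> :: "(real ^ 't::finite) set"
    and \<theta>\<^sub>0 :: "real ^ 't"
    and f :: "'y::finite \<Rightarrow> 'x \<Rightarrow> 'a \<Rightarrow> real ^ 't \<Rightarrow> real"
    and prior :: "'a \<Rightarrow> 'x \<Rightarrow> real"
    and P :: "'x \<Rightarrow> 'a \<Rightarrow> 'y pmf"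
    and x :: 'x
  assumes borel_M: "sets M = sets (restrict_space borel \<A>)"
    and open_pos: "\<And>U. open U \<Longrightarrow> U \<inter> \<A> \<noteq> {} \<Longrightarrow> emeasure M (U \<inter> \<A>) > 0"
    and theta0: "\<theta>\<^sub>0 \<in> \<Theta>"
    and f_nonneg: "\<And>y x \<alpha> \<theta>. x \<in> \<X> \<Longrightarrow> \<alpha> \<in> \<A> \<Longrightarrow> \<theta> \<in> \<Theta> \<Longrightarrow> f y x \<alpha> \<theta> \<ge> 0"
    and f_sum: "\<And>x \<alpha> \<theta>. x \<in> \<X> \<Longrightarrow> \<alpha> \<in> \<A> \<Longrightarrow> \<theta> \<in> \<Theta> \<Longrightarrow> (\<Sum>y\<in>UNIV. f y x \<alpha> \<theta>) = 1"
    and f_meas: "\<And>y x \<theta>. x \<in> \<X> \<Longrightarrow> \<theta> \<in> \<Theta> \<Longrightarrow> (\<lambda>\<alpha>. f y x \<alpha> \<theta>) \<in> borel_measurable M"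
    and prior_int: "\<And>x. x \<in> \<X> \<Longrightarrow> (LINT \<alpha>|M. prior \<alpha> x) = 1"
    and x: "x \<in> \<X>"
    and model: "\<And>y \<alpha>. \<alpha> \<in> \<A> \<Longrightarrow> pmf (P x \<alpha>) y = f y x \<alpha> \<theta>\<^sub>0"
    and prior_pos: "\<And>\<alpha> x. \<alpha> \<in> \<A> \<Longrightarrow> x \<in> \<X> \<Longrightarrow> prior \<alpha> x > 0"
    and p_prior_pos: "\<And>y. p_prior M f prior y x \<theta>\<^sub>0 > 0"
    and f_cont: "\<And>y. continuous_on \<A> (\<lambda>\<alpha>. f y x \<alpha> \<theta>\<^sub>0)"
  shows
    "(\<forall>s :: 'y \<Rightarrow> 'x \<Rightarrow> real ^ 't \<Rightarrow> real ^ 's::finite. \<forall>\<alpha>\<in>\<A>.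
        cond_expectation P (\<lambda>y x. limit_score M f prior s y x \<theta>\<^sub>0) x \<alpha> = 0)
   \<and> (eigenvalue (Q_matrix M f prior x \<theta>\<^sub>0) 0 \<longleftrightarrow>
        (\<exists>m :: 'y \<Rightarrow> 'x \<Rightarrow> real ^ 't \<Rightarrow> real. (\<exists>y. m y x \<theta>\<^sub>0 \<noteq> 0) \<and>
          (\<forall>\<alpha>\<in>\<A>. cond_expectation P (\<lambda>y x. m y x \<theta>\<^sub>0) x \<alpha> = 0)))
   \<and> (\<forall>m :: 'y \<Rightarrow> 'x \<Rightarrow> real ^ 't \<Rightarrow> real.
        (\<forall>\<alpha>\<in>\<A>. cond_expectation P (\<lambda>y x. m y x \<theta>\<^sub>0) x \<alpha> = 0) \<longrightarrow>
        (\<exists>s :: 'y \<Rightarrow> 'x \<Rightarrow> real ^ 't \<Rightarrow> real. \<forall>y.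
          m y x \<theta>\<^sub>0 = limit_score M f prior (\<lambda>y x \<theta>. vec (s y x \<theta>) :: real ^ 1) y x \<theta>\<^sub>0 $ 1))"
proof -
  let ?w = "\<lambda>y \<alpha>. f y x \<alpha> \<theta>\<^sub>0" and ?\<pi> = "\<lambda>\<alpha>. prior \<alpha> x"
  let ?p = "\<lambda>y. p_prior M f prior y x \<theta>\<^sub>0" and ?Q = "Q_matrix M f prior x \<theta>\<^sub>0"
  have space: "space M = \<A>"
    using sets_eq_imp_space_eq[OF borel_M] by (simp add: space_restrict_space)
  interpret weighted_mixture M ?w ?\<pi>
  proof
    \<comment> \<open>A non-integrable function has Bochner integral 0 by convention, so total mass
      1 already forces integrability.\<close>
    show "integrable M ?\<pi>"
      using prior_int[OF x] not_integrable_integral_eq[of M ?\<pi>] by fastforce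
  qed (use x theta0 in \<open>auto simp: space prior_pos f_nonneg f_sum f_meas\<close>)
  \<comment> \<open>Continuity in \<alpha> and positive measure of open sets turn the a.e.
    description of the kernel into one valid at every \<alpha>.\<close>
  have kernel: "gram *v u = 0 \<longleftrightarrow> (\<forall>\<alpha>\<in>\<A>. (\<Sum>y\<in>UNIV. u $ y * ?w y \<alpha>) = 0)" for u
  proof -
    have "continuous_on \<A> (\<lambda>\<alpha>. \<Sum>y\<in>UNIV. u $ y * ?w y \<alpha>)"
      by (intro continuous_intros f_cont)
    then show ?thesis
      unfolding gram_kernel_AE
      using AE_zero_imp_zero_of_continuous_on[OF borel_M open_pos] by (auto simp: space)
  qed
  have moment: "(\<forall>\<alpha>\<in>\<A>. cond_expectation P (\<lambda>y x. m y x \<theta>\<^sub>0) x \<alpha> = 0)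
      \<longleftrightarrow> gram *v (\<chi> y. m y x \<theta>\<^sub>0) = 0" for m :: "'y \<Rightarrow> 'x \<Rightarrow> real ^ 't \<Rightarrow> real"
    unfolding kernel by (simp add: cond_expectation_finite model mult.commute)
  have Q: "?Q $ k $ l = gram $ k $ l / ?p l" for k l
    by (simp add: Q_matrix_def post_predictive_def post_density_def gram_def mult.assoc)
  have limit: "\<exists>z. gram *v z = 0 \<and> (\<lambda>q. u v* matrix_power (mat 1 - ?Q) q) \<longlonglongrightarrow> z" for u
  proof -
    have "(gram *v v) \<bullet> v \<le> (\<Sum>k\<in>UNIV. ?p k * (v $ k)\<^sup>2)" for v
      unfolding p_prior_def by (rule gram_form_le)
    from symmetrizable_row_powers_converge[OF p_prior_pos Q transpose_gram gram_form_nonneg this]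
    show ?thesis by blast
  qed
  have score: "cond_expectation P (\<lambda>y x. limit_score M f prior s y x \<theta>\<^sub>0) x \<alpha> = 0"
    if \<alpha>: "\<alpha> \<in> \<A>" for \<alpha> and s :: "'y \<Rightarrow> 'x \<Rightarrow> real ^ 't \<Rightarrow> real ^ 's"
  proof -
    let ?S = "\<lambda>i. \<chi> k. s k x \<theta>\<^sub>0 $ i"
    have "\<forall>i. \<exists>z. gram *v z = 0 \<and> (\<lambda>q. ?S i v* matrix_power (mat 1 - ?Q) q) \<longlonglongrightarrow> z"
      by (intro allI limit)
    from choice[OF this] obtain z where z: "\<And>i. gram *v z i = 0"
      "\<And>i. (\<lambda>q. ?S i v* matrix_power (mat 1 - ?Q) q) \<longlonglongrightarrow> z i"
      by blast
    \<comment> \<open>Convergence holds coordinatewise, so \<open>lim\<close> is the genuine limit,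
      with coordinates in the Gram kernel, that is, moment functions.\<close>
    have "limit_score M f prior s y x \<theta>\<^sub>0 = (\<chi> i. z i $ y)" for y
      unfolding limit_score_def
      by (intro limI vec_tendstoI)
        (auto simp: bias_corrected_score_component intro!: tendsto_vec_nth z(2))
    moreover have "(\<Sum>y\<in>UNIV. z i $ y * ?w y \<alpha>) = 0" for i
      using z(1) kernel \<alpha> by blast
    ultimately show ?thesis
      by (simp add: cond_expectation_finite model[OF \<alpha>] vec_eq_iff mult.commute)
  qed
  \<comment> \<open>A vector lies in the kernel of Q exactly when its entries divided by the prior
    predictive probabilities lie in the Gram kernel. The two directions of \<open>eig\<close> pass
    between eigenvectors and moment functions by this division and its inverse.\<close>
  have Q_mult: "?Q *v v = gram *v (\<chi> y. v $ y / ?p y)" for v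
    by (simp add: vec_eq_iff matrix_vector_mult_def Q)
  have eig: "eigenvalue ?Q 0 \<longleftrightarrow>
      (\<exists>m :: 'y \<Rightarrow> 'x \<Rightarrow> real ^ 't \<Rightarrow> real. (\<exists>y. m y x \<theta>\<^sub>0 \<noteq> 0) \<and>
        (\<forall>\<alpha>\<in>\<A>. cond_expectation P (\<lambda>y x. m y x \<theta>\<^sub>0) x \<alpha> = 0))"
    unfolding moment
  proof
    assume "eigenvalue ?Q 0"
    then obtain v where v: "v \<noteq> 0" "gram *v (\<chi> y. v $ y / ?p y) = 0"
      by (auto simp: eigenvalue_def Q_mult)
    then obtain y where "v $ y / ?p y \<noteq> 0"
      using p_prior_pos by (auto simp: vec_eq_iff less_le)
    with v(2) show "\<exists>m :: 'y \<Rightarrow> 'x \<Rightarrow> real ^ 't \<Rightarrow> real.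
        (\<exists>y. m y x \<theta>\<^sub>0 \<noteq> 0) \<and> gram *v (\<chi> y. m y x \<theta>\<^sub>0) = 0"
      by (intro exI[of _ "\<lambda>y _ _. v $ y / ?p y"]) blast
  next
    assume "\<exists>m :: 'y \<Rightarrow> 'x \<Rightarrow> real ^ 't \<Rightarrow> real.
        (\<exists>y. m y x \<theta>\<^sub>0 \<noteq> 0) \<and> gram *v (\<chi> y. m y x \<theta>\<^sub>0) = 0"
    then obtain m y where m: "m y x \<theta>\<^sub>0 \<noteq> 0" "gram *v (\<chi> y. m y x \<theta>\<^sub>0) = 0"
      by blast
    let ?v = "\<chi> y. ?p y * m y x \<theta>\<^sub>0"
    have p: "?p y \<noteq> 0" for y using p_prior_pos[of y] by simp
    have "?v \<noteq> 0" using m(1) p by (auto simp: vec_eq_iff)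
    moreover have "?Q *v ?v = 0" using m(2) p by (simp add: Q_mult)
    ultimately show "eigenvalue ?Q 0" unfolding eigenvalue_def by auto
  qed
  \<comment> \<open>The witness for the score is \<open>m\<close> itself: as a row it annihilates
    the Gram matrix, hence Q, so every power of \<open>mat 1 - ?Q\<close> fixes it and the sequence
    of scores is constant. \<open>real ^ 1\<close> encodes a scalar score.\<close>
  have fix_score: "m y x \<theta>\<^sub>0 = limit_score M f prior (\<lambda>y x \<theta>. vec (m y x \<theta>) :: real ^ 1) y x \<theta>\<^sub>0 $ 1"
    if "\<forall>\<alpha>\<in>\<A>. cond_expectation P (\<lambda>y x. m y x \<theta>\<^sub>0) x \<alpha> = 0"
    for m :: "'y \<Rightarrow> 'x \<Rightarrow> real ^ 't \<Rightarrow> real" and y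
  proof -
    let ?u = "\<chi> y. m y x \<theta>\<^sub>0"
    have "gram *v ?u = 0" using that moment by blast
    then have "?u v* gram = 0"
      using transpose_matrix_vector[of gram ?u] by (simp add: transpose_gram)
    then have "(\<Sum>k\<in>UNIV. m k x \<theta>\<^sub>0 * gram $ k $ l) = 0" for l
      by (simp add: vec_eq_iff vector_matrix_mult_def)
    then have "?u v* ?Q = 0"
      by (simp add: vec_eq_iff vector_matrix_mult_def Q flip: sum_divide_distrib)
    then have "?u v* matrix_power (mat 1 - ?Q) q = ?u" for q
      by (induction q)
        (simp_all add: vector_matrix_mult_diff_rdistrib flip: vector_matrix_mul_assoc)
    then have "bias_corrected_score M f prior (\<lambda>y x \<theta>. vec (m y x \<theta>) :: real ^ 1) q y x \<theta>\<^sub>0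
        = vec (m y x \<theta>\<^sub>0)" for q
      by (simp add: vec_eq_iff bias_corrected_score_component)
    then show ?thesis by (simp add: limit_score_def limI[OF tendsto_const])
  qed
  show ?thesis using score eig fix_score by blast
qed

end
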